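(* Let $p$ be an odd prime and $\alpha,\beta\in\mathbb Z_p$. If $\langle-\alpha\rangle_p+\langle-\beta\rangle_p<p$, then $$ {}_2F_1\bigg[\begin{matrix}\alpha&\beta\\&1\end{matrix}\bigg|\,1\bigg]_{p-1}\equiv-\frac{\Gamma_p(1-\alpha-\beta)}{\Gamma_p(1-\alpha)\Gamma_p(1-\beta)}\pmod{p^2}. $$ If $\langle-\alpha\rangle_p+\langle-\beta\rangle_p\geq p$, then $$ {}_2F_1\bigg[\begin{matrix}\alpha&\beta\\&1\end{matrix}\bigg|\,1\bigg]_{p-1}\equiv\big(\alpha+\beta+\langle-\alpha\rangle_p+\langle-\beta\rangle_p-p\big)\cdot\frac{\Gamma_p(1-\alpha-\beta)}{\Gamma_p(1-\alpha)\Gamma_p(1-\beta)}\pmod{p^2}. $$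
   Context: $\mathbb Z_p$ denotes the $p$-adic integers. For $\alpha\in\mathbb Z_p$, $\langle\alpha\rangle_p$ is the unique integer in $\{0,1,\ldots,p-1\}$ congruent to $\alpha$ modulo $p$. Pochhammer symbol: $(x)_0=1$, $(x)_k=x(x+1)\cdots(x+k-1)$ for $k\ge1$. For $n\ge 0$ the truncated hypergeometric series is ${}_{m+1}F_m\Big[\begin{matrix}\alpha_0&\alpha_1&\ldots&\alpha_m\\&\beta_1&\ldots&\beta_m\end{matrix}\Big|\,z\Big]_n=\sum_{k=0}^{n}\frac{(\alpha_0)_k\cdots(\alpha_m)_k}{(\beta_1)_k\cdots(\beta_m)_k}\cdot\frac{z^k}{k!}$. $\Gamma_p$ is Morita's $p$-adic gamma function: $\Gamma_p(n)=(-1)^n\prod_{1\le j<n,\ p\nmid j}j$ for integers $n\ge1$, $\Gamma_p(0)=1$, extended to $\mathbb Z_p$ by continuity. For $x,y\in\mathbb Q_p$, $x\equiv y\pmod{p^2}$ means $x-y\in p^2\mathbb Z_p$. *)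

theory Defs
  imports
    "HOL-Analysis.Analysis"
    "HOL-Computational_Algebra.Computational_Algebra"
    "Berlekamp_Zassenhaus.Finite_Field"
begin

text \<open>
  The prime \<open>p\<close> is \<open>CARD('p)\<close> for a type variable \<open>'p\<close> of class \<^class>\<open>prime_card\<close>.
  The ring of \<open>p\<close>-adic integers is the inverse limit of the rings \<open>\<int>/p\<^sup>n\<close>: the entry at
  \<open>n\<close> is the representative in \<open>{0..<p\<^sup>n}\<close> of the reduction modulo \<open>p\<^sup>n\<close>.
\<close>

typedef (overloaded) ('p::prime_card) padic_int =
  "{x :: nat \<Rightarrow> int. \<forall>n. x n \<in> {0..<int CARD('p) ^ n} \<and> x (Suc n) mod int CARD('p) ^ n = x n}"
  by (rule exI[of _ "\<lambda>_. 0"]) (simp add: zero_less_power)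

setup_lifting type_definition_padic_int

lemma CARD_prime_card_pos: "0 < int CARD('p::prime_card)"
  using prime_card[where ?'a = 'p] by (simp add: prime_gt_0_nat)

lemma mod_power_Suc_mod: "(a::int) mod q ^ Suc n mod q ^ n = a mod q ^ n"
  by (rule mod_mod_cancel) (rule le_imp_power_dvd, simp)

instantiation padic_int :: (prime_card) comm_ring_1
begin

lift_definition zero_padic_int :: "'a padic_int" is "\<lambda>n. 0"
  using CARD_prime_card_pos[where ?'p = 'a] by simp

lift_definition one_padic_int :: "'a padic_int" is "\<lambda>n. 1 mod int CARD('a) ^ n"
  using CARD_prime_card_pos[where ?'p = 'a] by (simp only: mod_power_Suc_mod) simp

lift_definition plus_padic_int :: "'a padic_int \<Rightarrow> 'a padic_int \<Rightarrow> 'a padic_int"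
  is "\<lambda>x y n. (x n + y n) mod int CARD('a) ^ n"
  subgoal for x y
    using CARD_prime_card_pos[where ?'p = 'a]
    by (simp only: mod_power_Suc_mod) (auto, metis mod_add_eq)
  done

lift_definition uminus_padic_int :: "'a padic_int \<Rightarrow> 'a padic_int"
  is "\<lambda>x n. (- x n) mod int CARD('a) ^ n"
  subgoal for x
    using CARD_prime_card_pos[where ?'p = 'a]
    by (simp only: mod_power_Suc_mod) (auto, metis mod_minus_eq)
  done

lift_definition minus_padic_int :: "'a padic_int \<Rightarrow> 'a padic_int \<Rightarrow> 'a padic_int"
  is "\<lambda>x y n. (x n - y n) mod int CARD('a) ^ n"
  subgoal for x y
    using CARD_prime_card_pos[where ?'p = 'a]
    by (simp only: mod_power_Suc_mod) (auto, metis mod_diff_eq)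
  done

lift_definition times_padic_int :: "'a padic_int \<Rightarrow> 'a padic_int \<Rightarrow> 'a padic_int"
  is "\<lambda>x y n. (x n * y n) mod int CARD('a) ^ n"
  subgoal for x y
    using CARD_prime_card_pos[where ?'p = 'a]
    by (simp only: mod_power_Suc_mod) (auto, metis mod_mult_eq)
  done

instance
proof
  show "(0::'a padic_int) \<noteq> 1"
    using prime_card[where ?'a = 'a]
    by transfer (auto dest!: fun_cong[where x = 1] simp: prime_gt_1_nat)
qed (transfer, auto simp: fun_eq_iff mod_simps algebra_simps)+

end

lemma Rep_zero: "Rep_padic_int 0 n = 0"
  by transfer simp

lemma Rep_minus:
  "Rep_padic_int (x - y :: 'p padic_int) n = (Rep_padic_int x n - Rep_padic_int y n) mod int CARD('p::prime_card) ^ n"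
  by transfer simp

lemma Rep_times:
  "Rep_padic_int (x * y :: 'p padic_int) n = (Rep_padic_int x n * Rep_padic_int y n) mod int CARD('p::prime_card) ^ n"
  by transfer simp

lemma Rep_of_nat:
  "Rep_padic_int (of_nat m :: 'p padic_int) n = int m mod int CARD('p::prime_card) ^ n"
proof (induction m)
  case 0
  show ?case by (simp add: Rep_zero)
next
  case (Suc m)
  have "Rep_padic_int (1 + y :: 'p padic_int) n = (1 + Rep_padic_int y n) mod int CARD('p) ^ n" for y
    by transfer (simp add: mod_simps)
  with Suc show ?case by (simp add: mod_simps)
qed

lemma Rep_mod:
  "Rep_padic_int (x :: 'p padic_int) (n + k) mod int CARD('p::prime_card) ^ n = Rep_padic_int x n"
proof (induction k)
  case 0
  show ?case using Rep_padic_int[of x] by auto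
next
  case (Suc k)
  have "Rep_padic_int x (n + Suc k) mod int CARD('p) ^ n
      = Rep_padic_int x (Suc (n + k)) mod int CARD('p) ^ (n + k) mod int CARD('p) ^ n"
    by (subst mod_mod_cancel) (auto simp: le_imp_power_dvd)
  with Suc show ?case using Rep_padic_int[of x] by auto
qed

lemma padic_int_nonzeroE:
  assumes "(x :: 'p::prime_card padic_int) \<noteq> 0"
  obtains n where "Rep_padic_int x n \<noteq> 0"
  using assms by (metis Rep_padic_int_inject Rep_zero ext)

lemma prime_power_dvd_times:
  fixes q u v :: int
  assumes "prime q" "q ^ (a + b) dvd u * v" "\<not> q ^ a dvd u" "\<not> q ^ b dvd v"
  shows False
proof -
  have nz: "u \<noteq> 0" "v \<noteq> 0" using assms by auto
  have "multiplicity q u < a" "multiplicity q v < b"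
    using assms nz by (auto simp: not_le[symmetric] multiplicity_dvd')
  moreover have "a + b \<le> multiplicity q (u * v)"
    using assms nz by (intro multiplicity_geI) auto
  ultimately show False
    using prime_elem_multiplicity_mult_distrib[OF prime_imp_prime_elem[OF assms(1)] nz] by linarith
qed

instance padic_int :: (prime_card) idom
proof
  fix x y :: "'a padic_int"
  let ?q = "int CARD('a)"
  assume "x \<noteq> 0" "y \<noteq> 0"
  then obtain a b where ab: "Rep_padic_int x a \<noteq> 0" "Rep_padic_int y b \<noteq> 0"
    by (metis padic_int_nonzeroE)
  show "x * y \<noteq> 0"
  proof
    assume "x * y = 0"
    hence "?q ^ (a + b) dvd Rep_padic_int x (a + b) * Rep_padic_int y (a + b)"
      using Rep_times[of x y "a + b"] by (simp add: Rep_zero mod_eq_0_iff_dvd)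
    moreover have "\<not> ?q ^ a dvd Rep_padic_int x (a + b)" "\<not> ?q ^ b dvd Rep_padic_int y (a + b)"
      using ab Rep_mod[of x a b] Rep_mod[of y b a] by (auto simp: add.commute mod_eq_0_iff_dvd)
    ultimately show False
      using prime_power_dvd_times[of ?q a b] prime_card[where ?'a = 'a] by auto
  qed
qed

text \<open>The \<open>p\<close>-adic valuation; its value at \<open>0\<close> is irrelevant.\<close>

definition padic_val :: "'p::prime_card padic_int \<Rightarrow> nat"
  where "padic_val x = (GREATEST n. of_nat CARD('p) ^ n dvd x)"

lemma padic_power_dvd_bound:
  assumes "Rep_padic_int (x :: 'p::prime_card padic_int) a \<noteq> 0" "of_nat CARD('p) ^ n dvd x"
  shows "n \<le> a"
proof (rule ccontr)
  assume "\<not> n \<le> a"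
  hence "int CARD('p) ^ a dvd int CARD('p) ^ n"
    by (simp add: le_imp_power_dvd)
  moreover obtain z where "x = of_nat (CARD('p) ^ n) * z"
    using assms(2) by (auto elim: dvdE)
  ultimately have "Rep_padic_int x a = 0"
    by (simp only: Rep_times Rep_of_nat) (simp add: mod_simps mod_eq_0_iff_dvd)
  with assms(1) show False by simp
qed

lemma padic_val_dvd:
  assumes "(x :: 'p::prime_card padic_int) \<noteq> 0"
  shows "of_nat CARD('p) ^ padic_val x dvd x"
proof -
  obtain a where "Rep_padic_int x a \<noteq> 0" using assms by (rule padic_int_nonzeroE)
  thus ?thesis unfolding padic_val_def
    using GreatestI_nat[of "\<lambda>n. of_nat CARD('p) ^ n dvd x" 0 a] padic_power_dvd_bound by auto
qed

lemma padic_val_ge: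
  assumes "(x :: 'p::prime_card padic_int) \<noteq> 0" "of_nat CARD('p) ^ n dvd x"
  shows "n \<le> padic_val x"
proof -
  obtain a where "Rep_padic_int x a \<noteq> 0" using assms(1) by (rule padic_int_nonzeroE)
  thus ?thesis unfolding padic_val_def
    using Greatest_le_nat[of "\<lambda>n. of_nat CARD('p) ^ n dvd x" n a] padic_power_dvd_bound assms(2)
    by auto
qed

instantiation padic_int :: (prime_card) metric_space
begin

definition dist_padic_int :: "'a padic_int \<Rightarrow> 'a padic_int \<Rightarrow> real"
  where "dist_padic_int x y = (if x = y then 0 else inverse (real CARD('a)) ^ padic_val (x - y))"

definition uniformity_padic_int :: "('a padic_int \<times> 'a padic_int) filter"
  where "uniformity_padic_int = (INF e\<in>{0<..}. principal {(x, y). dist x y < e})"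

definition open_padic_int :: "'a padic_int set \<Rightarrow> bool"
  where "open_padic_int U \<longleftrightarrow> (\<forall>x\<in>U. \<forall>\<^sub>F (x', y) in uniformity. x' = x \<longrightarrow> y \<in> U)"

instance
proof
  fix x y z :: "'a padic_int"
  let ?p = "of_nat CARD('a) :: 'a padic_int"
  have r: "0 < inverse (real CARD('a))" "inverse (real CARD('a)) \<le> 1"
    using prime_gt_0_nat[OF prime_card[where ?'a = 'a]] by (auto simp: field_simps)
  show "(dist x y = 0) = (x = y)"
    using r by (auto simp: dist_padic_int_def)
  show "dist x y \<le> dist x z + dist y z"
  proof (cases "x = y \<or> x = z \<or> y = z")
    case True
    have "padic_val (a - b) = padic_val (b - a)" for a b :: "'a padic_int"
      using dvd_minus_iff[of _ "a - b"] by (simp add: padic_val_def)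
    hence "dist y x = dist x y" "dist z y = dist y z"
      by (simp_all add: dist_padic_int_def)
    moreover have "0 \<le> dist a b" for a b :: "'a padic_int"
      using r by (simp add: dist_padic_int_def)
    ultimately show ?thesis using True by (auto simp: dist_padic_int_def)
  next
    case False
    define m where "m = min (padic_val (x - z)) (padic_val (y - z))"
    have "?p ^ m dvd x - z" "?p ^ m dvd y - z"
      using False padic_val_dvd[of "x - z"] padic_val_dvd[of "y - z"]
      by (auto simp: m_def intro: dvd_trans[OF le_imp_power_dvd[OF min.cobounded1]]
          dvd_trans[OF le_imp_power_dvd[OF min.cobounded2]])
    hence "?p ^ m dvd (x - z) - (y - z)" by (rule dvd_diff)
    hence "m \<le> padic_val (x - y)"
      using False by (intro padic_val_ge) auto
    hence "dist x y \<le> inverse (real CARD('a)) ^ m"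
      using False r by (simp add: dist_padic_int_def power_decreasing del: power_inverse)
    also have "\<dots> \<le> dist x z + dist y z"
      using False r by (auto simp: dist_padic_int_def m_def min_def simp del: power_inverse)
    finally show ?thesis .
  qed
qed (simp_all add: uniformity_padic_int_def open_padic_int_def)

end

text \<open>
  The field \<open>\<rat>\<^sub>p\<close> of \<open>p\<close>-adic numbers is the fraction field of \<^typ>\<open>'p padic_int\<close>, with
  embedding \<^const>\<open>to_fract\<close>.
\<close>

type_synonym 'p padic = "'p padic_int fract"

text \<open>Congruence modulo \<open>p\<^sup>n \<int>\<^sub>p\<close>.\<close>

definition padic_cong :: "nat \<Rightarrow> 'p::prime_card padic \<Rightarrow> 'p padic \<Rightarrow> bool"
  where "padic_cong n x y \<longleftrightarrow> (\<exists>z. x - y = of_nat CARD('p) ^ n * to_fract z)"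

definition padic_residue :: "'p::prime_card padic_int \<Rightarrow> nat"
  where "padic_residue x = (THE r. r < CARD('p) \<and> of_nat CARD('p) dvd x - of_nat r)"

definition hypergeo_trunc :: "'a::field list \<Rightarrow> 'a list \<Rightarrow> 'a \<Rightarrow> nat \<Rightarrow> 'a"
  where "hypergeo_trunc as bs z n =
    (\<Sum>k\<le>n. (\<Prod>a\<leftarrow>as. pochhammer a k) / (\<Prod>b\<leftarrow>bs. pochhammer b k) * (z ^ k / of_nat (fact k)))"

text \<open>
  Morita's \<open>p\<close>-adic gamma function on the natural numbers (for \<open>n = 0\<close> the formula gives \<open>1\<close>),
  and its unique continuous extension to the \<open>p\<close>-adic integers.
\<close>

definition padic_Gamma_nat :: "nat \<Rightarrow> 'p::prime_card padic_int"
  where "padic_Gamma_nat n = (-1) ^ n * of_nat (\<Prod>j | 1 \<le> j \<and> j < n \<and> \<not> CARD('p) dvd j. j)"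

definition padic_Gamma :: "'p::prime_card padic_int \<Rightarrow> 'p padic_int"
  where "padic_Gamma = (THE f. continuous_on UNIV f \<and> (\<forall>n. f (of_nat n) = padic_Gamma_nat n))"

end

(*
  Both sides only depend on alpha and beta modulo p^2, so one may take alpha = -m and beta = -n with
  m = p s + a, n = p t + b natural and a, b < p. The left-hand side becomes the sum over k < p of
  (m choose k) (n choose k). After clearing denominators, both sides are affine functions of
  (p s, p t) modulo p^2, so they agree as soon as they agree for (s, t) = (0, 0), (1, 0), (0, 1).
  At these points one of m, n is less than p, hence the sum is complete and equals (m + n choose n)
  by Vandermonde, while the gamma quotient is a quotient of factorials: exact equality holds.
*)

theory Submission
  imports Defs "HOL-Number_Theory.Number_Theory"
begin

text \<open>For general (s, t) no exact identity is available: when s and t are both positive the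
  sum over k < p omits nonzero Vandermonde terms, and comparing factorials with gamma values leaves
  a factor (s + t choose s), which is not affine. Both defects disappear when s or t is 0, which
  holds at the three interpolation points. The factor of the second case is a carry: if a + b \<ge>
  p, then (m + n) div p = s + t + 1, which contributes p (s + t + 1), and this is -(\<alpha> +
  \<beta> + a + b - p) at \<alpha> = -m, \<beta> = -n. The arithmetic input is that gamma values are
  affine modulo p^2. It rests on Gamma_p(k p) being congruent to Gamma_p(p)^k modulo p^2 and on
  Wilson's theorem. Since \<open>padic_Gamma\<close> is a definite description, the continuous
  extension must be shown to exist and to be unique. This requires congruences modulo every p^n;
  they also show that gamma values modulo p^2 depend only on the argument modulo p^2.\<close>

section \<open>Morita's gamma function on the natural numbers\<close>

text \<open>
  The factor \<open>- 1\<close> at the multiples of \<open>p\<close> (including \<open>0\<close>) accounts for the sign \<open>(-1)\<^sup>n\<close>.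
\<close>

definition morita :: "nat \<Rightarrow> nat \<Rightarrow> int"
  where "morita p n = (\<Prod>j<n. if p dvd j then - 1 else - int j)"

lemma morita_0: "morita p 0 = 1"
  by (simp add: morita_def)

lemma morita_Suc: "morita p (Suc n) = morita p n * (if p dvd n then - 1 else - int n)"
  by (simp add: morita_def)

text \<open>The factors of n! prime to p make up the gamma value at n + 1 up to sign; the multiples
  of p, each divided by p, make up (n div p)!.\<close>

lemma fact_eq_morita:
  assumes "p > 0"
  shows "fact n = (- 1) ^ Suc n * morita p (Suc n) * int (p ^ (n div p)) * fact (n div p)"
proof (induction n)
  case 0
  show ?case by (simp add: morita_Suc morita_0)
next
  case (Suc n)
  show ?case
  proof (cases "p dvd Suc n")
    case True
    then obtain k where k: "Suc n = p * k" by (auto elim: dvdE)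
    then obtain l where l: "k = Suc l" by (cases k) auto
    have "n div p = l" using k l assms
      by (intro div_nat_eqI) auto
    moreover have "Suc n div p = Suc l" using k l assms by simp
    moreover have "fact (Suc n) = int p * int k * fact n" using k by (metis fact_Suc of_nat_mult)
    moreover have "morita p (Suc (Suc n)) = - morita p (Suc n)"
      using True by (simp add: morita_Suc[of _ "Suc n"])
    ultimately show ?thesis
      using Suc.IH l by (simp add: algebra_simps del: fact_Suc) (simp add: algebra_simps)
  next
    case False
    hence "Suc n div p = n div p" by (simp add: div_Suc dvd_eq_mod_eq_0)
    thus ?thesis
      using Suc.IH False by (simp add: morita_Suc[of _ "Suc n"] algebra_simps)
  qed
qed

text \<open>The order of quantifiers matters: one S serves all y, so what is learned about S at y =
  -q can be used at y = q * i.\<close>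

lemma prod_shift_expansion:
  fixes c :: "'b \<Rightarrow> int"
  assumes "finite A"
  shows "\<exists>S. \<forall>y. [(\<Prod>j\<in>A. y + c j) = (\<Prod>j\<in>A. c j) + y * S] (mod y\<^sup>2)"
  using assms
proof (induction A rule: finite_induct)
  case empty
  show ?case by (auto intro: exI[of _ 0])
next
  case (insert a A)
  then obtain S where S: "\<And>y. [(\<Prod>j\<in>A. y + c j) = (\<Prod>j\<in>A. c j) + y * S] (mod y\<^sup>2)"
    by blast
  have "[(\<Prod>j\<in>insert a A. y + c j) = (\<Prod>j\<in>insert a A. c j) + y * ((\<Prod>j\<in>A. c j) + c a * S)] (mod y\<^sup>2)" for y
  proof -
    have "[(\<Prod>j\<in>insert a A. y + c j) = (y + c a) * ((\<Prod>j\<in>A. c j) + y * S)] (mod y\<^sup>2)"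
      using insert.hyps S[of y] by (auto intro: cong_mult)
    also have "(y + c a) * ((\<Prod>j\<in>A. c j) + y * S) =
        (\<Prod>j\<in>insert a A. c j) + y * ((\<Prod>j\<in>A. c j) + c a * S) + y\<^sup>2 * S"
      using insert.hyps by (simp add: algebra_simps power2_eq_square)
    also have "[\<dots> = (\<Prod>j\<in>insert a A. c j) + y * ((\<Prod>j\<in>A. c j) + c a * S)] (mod y\<^sup>2)"
      by (simp add: cong_iff_dvd_diff)
    finally show ?thesis .
  qed
  thus ?case by blast
qed

text \<open>
  The reflection \<open>j \<mapsto> q - j\<close> makes the product invariant under \<open>X \<mapsto> - q - X\<close>, which kills the
  linear term modulo \<open>q\<^sup>2\<close>.
\<close>

lemma prod_totatives_shift_cong:
  fixes q :: nat and i :: int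
  assumes "q > 2"
  shows "[(\<Prod>j\<in>totatives q. int q * i + int j) = (\<Prod>j\<in>totatives q. int j)] (mod (int q)\<^sup>2)"
proof -
  let ?W = "\<Prod>j\<in>totatives q. int j"
  obtain S where S: "\<And>y. [(\<Prod>j\<in>totatives q. y + int j) = ?W + y * S] (mod y\<^sup>2)"
    using prod_shift_expansion[of "totatives q" int] by auto
  have bij: "bij_betw (\<lambda>j. q - j) (totatives q) (totatives q)"
  proof (rule bij_betw_byWitness[where f' = "\<lambda>j. q - j"])
    have reflect: "q - j \<in> totatives q" if "j \<in> totatives q" for j
    proof -
      have "j < q" using totatives_less[OF that] assms by simp
      moreover have "coprime (q - j) q"
        using that \<open>j < q\<close> gcd_diff2_nat[of j q]
        unfolding in_totatives_iff coprime_iff_gcd_eq_1 by simp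
      ultimately show ?thesis by (simp add: in_totatives_iff)
    qed
    show "(\<lambda>j. q - j) ` totatives q \<subseteq> totatives q"
      "(\<lambda>j. q - j) ` totatives q \<subseteq> totatives q"
      using reflect by auto
  qed (auto simp: totatives_le)
  have "(\<Prod>j\<in>totatives q. - int q + int j) = (\<Prod>j\<in>totatives q. - int (q - j))"
    by (rule prod.cong) (auto simp: totatives_le of_nat_diff)
  also have "\<dots> = (- 1) ^ totient q * (\<Prod>j\<in>totatives q. int (q - j))"
    by (simp add: prod_uminus totient_def)
  also have "even (totient q)" using assms by (rule totient_even)
  hence "(- 1) ^ totient q = (1 :: int)" by simp
  also have "1 * (\<Prod>j\<in>totatives q. int (q - j)) = ?W"
    using prod.reindex_bij_betw[OF bij, of int] by simp
  finally have "[?W = ?W - int q * S] (mod (int q)\<^sup>2)"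
    using S[of "- int q"] by simp
  hence *: "(int q)\<^sup>2 dvd int q * S" by (simp add: cong_iff_dvd_diff)
  have "(int q)\<^sup>2 dvd (int q * i)\<^sup>2" by simp
  hence "[(\<Prod>j\<in>totatives q. int q * i + int j) = ?W + (int q * i) * S] (mod (int q)\<^sup>2)"
    using S[of "int q * i"] cong_dvd_modulus by blast
  also have "(int q)\<^sup>2 dvd (int q * i) * S" using * by (metis dvd_mult mult.assoc mult.commute)
  hence "[?W + (int q * i) * S = ?W] (mod (int q)\<^sup>2)" by (simp add: cong_iff_dvd_diff)
  finally show ?thesis .
qed

text \<open>With q = p^n, the non-multiples of p below q are the totatives of q, so a block of q
  consecutive factors is a shifted product over totatives, with the same sign (-1)^q = -1 for every
  block.\<close>

lemma morita_block:
  assumes "prime p" "n > 0" "odd p"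
  shows "[(\<Prod>j = i * p ^ n..<i * p ^ n + p ^ n. if p dvd j then - 1 else - int j) = morita p (p ^ n)]
    (mod (int (p ^ n))\<^sup>2)"
proof -
  define q where "q = p ^ n"
  have "p > 2" using assms prime_ge_2_nat[of p] by (cases "p = 2") auto
  have "p \<le> q" using assms prime_gt_0_nat[of p] by (simp add: q_def self_le_power)
  have "p dvd q" "odd q" "q > 2" using assms \<open>p \<le> q\<close> \<open>p > 2\<close> by (auto simp: q_def)
  have tot: "totatives q = {j\<in>{..<q}. \<not> p dvd j}"
  proof (rule Set.set_eqI)
    fix j
    have "coprime j q \<longleftrightarrow> \<not> p dvd j"
    proof
      assume "coprime j q"
      thus "\<not> p dvd j" using \<open>p dvd q\<close> assms(1) coprime_common_divisor_nat[of j q p] by auto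
    next
      assume "\<not> p dvd j"
      hence "coprime p j" using assms(1) by (rule prime_imp_coprime[rotated])
      thus "coprime j q" by (simp add: q_def coprime_commute)
    qed
    moreover have "j \<noteq> 0" if "\<not> p dvd j" using that by (cases j) auto
    moreover have "j \<noteq> q" if "\<not> p dvd j" using that \<open>p dvd q\<close> by auto
    ultimately show "j \<in> totatives q \<longleftrightarrow> j \<in> {j\<in>{..<q}. \<not> p dvd j}"
      by (auto simp: totatives_def)
  qed
  have *: "(\<Prod>j = i * q..<i * q + q. if p dvd j then - 1 else - int j) =
      - (\<Prod>j\<in>totatives q. int q * int i + int j)" for i
  proof -
    have "(\<Prod>j = i * q..<i * q + q. if p dvd j then - 1 else - int j) =
        (\<Prod>j<q. if p dvd j then - 1 else - int (i * q + j))"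
      using prod.shift_bounds_nat_ivl[of "\<lambda>j. if p dvd j then - 1 else - int j" 0 "i * q" q]
        dvd_add_left_iff[OF dvd_mult[OF \<open>p dvd q\<close>], of _ i]
      by (simp add: lessThan_atLeast0 add.commute cong: if_cong)
    also have "\<dots> = (\<Prod>j<q. - 1 * (if p dvd j then 1 else int (i * q + j)))"
      by (rule prod.cong) auto
    also have "\<dots> = - (\<Prod>j<q. if p dvd j then 1 else int (i * q + j))"
      using \<open>odd q\<close> by (subst prod.distrib) simp
    also have "(\<Prod>j<q. if p dvd j then 1 else int (i * q + j)) = (\<Prod>j\<in>totatives q. int q * int i + int j)"
      unfolding tot by (subst prod.inter_filter) (auto intro!: prod.cong)
    finally show ?thesis .
  qed
  have "morita p q = - (\<Prod>j\<in>totatives q. int j)"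
    using *[of 0] by (simp add: morita_def lessThan_atLeast0)
  thus ?thesis
    using prod_totatives_shift_cong[OF \<open>q > 2\<close>, of "int i"] *[of i]
    by (simp add: q_def[symmetric] cong_minus_minus_iff)
qed

text \<open>The squared modulus is used twice: n = 1 gives the precision p^2 of the supercongruence,
  and for general n the inequality 2n \<ge> n + 1 drives the induction for prime powers.\<close>

lemma morita_mult_cong:
  assumes "prime p" "n > 0" "odd p"
  shows "[morita p (s * p ^ n) = morita p (p ^ n) ^ s] (mod (int (p ^ n))\<^sup>2)"
proof -
  have "morita p (s * p ^ n) =
      (\<Prod>i<s. \<Prod>j = i * p ^ n..<i * p ^ n + p ^ n. if p dvd j then - 1 else - int j)"
    unfolding morita_def by (rule prod.nat_group[symmetric])
  also have "[\<dots> = (\<Prod>i<s. morita p (p ^ n))] (mod (int (p ^ n))\<^sup>2)"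
    by (rule cong_prod) (rule morita_block[OF assms])
  finally show ?thesis by simp
qed

text \<open>In x^p - 1 = (x - 1)(1 + x + ... + x^(p-1)) the second factor is congruent to p, hence
  to 0, modulo p.\<close>

lemma power_prime_cong_1:
  fixes x :: int
  assumes "[x = 1] (mod int p ^ n)" "n > 0"
  shows "[x ^ p = 1] (mod int p ^ Suc n)"
proof -
  have "[x = 1] (mod int p)"
    using assms cong_dvd_modulus[of x 1 "int p ^ n" "int p"] by (simp add: dvd_power)
  hence "[(\<Sum>i<p. x ^ i) = (\<Sum>i<p. 1 ^ i)] (mod int p)"
    by (intro cong_sum cong_pow)
  hence "int p dvd (\<Sum>i<p. x ^ i)"
    using cong_dvd_iff[of "\<Sum>i<p. x ^ i" "\<Sum>i<p. 1 ^ i" "int p"] by (simp add: cong_dvd_iff)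
  moreover have "int p ^ n dvd x - 1" using assms by (simp add: cong_iff_dvd_diff)
  ultimately have "int p ^ n * int p dvd (x - 1) * (\<Sum>i<p. x ^ i)" by (rule mult_dvd_mono[rotated])
  thus ?thesis by (simp add: cong_iff_dvd_diff power_diff_1_eq mult.commute)
qed

text \<open>For odd p this is Wilson's theorem, since then (p - 1)! = -Gamma_p(p).\<close>

lemma morita_prime:
  assumes "prime p"
  shows "[morita p p = 1] (mod int p)"
proof -
  obtain k where k: "p = Suc k" using prime_gt_0_nat[OF assms] gr0_conv_Suc by blast
  have "fact k = (- 1) ^ p * morita p p"
    using fact_eq_morita[of p k] k by (simp del: power_Suc)
  hence "morita p p = - ((- 1) ^ k * fact k)"
    using k by simp
  show ?thesis
  proof (cases "p = 2")
    case True
    thus ?thesis by (simp add: numeral_2_eq_2 morita_Suc morita_0 cong_def)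
  next
    case False
    hence "even k" using prime_odd_nat[OF assms] prime_ge_2_nat[OF assms] k by auto
    hence "morita p p = - fact k" using \<open>morita p p = _\<close> by simp
    also have "[- fact k = - (- 1)] (mod int p)"
      using wilson_theorem[OF assms] k by (simp only: cong_minus_minus_iff) simp
    finally show ?thesis by simp
  qed
qed

text \<open>Gamma_p(p^(n+1)) agrees with the p-th power of Gamma_p(p^n) to sufficient precision, and
  taking the p-th power of a number congruent to 1 gains one power of p.\<close>

lemma morita_prime_power:
  assumes "prime p" "odd p" "n > 0"
  shows "[morita p (p ^ n) = 1] (mod int (p ^ n))"
  using \<open>n > 0\<close>
proof (induction n rule: nat_induct_non_zero)
  case 1
  show ?case using morita_prime[OF assms(1)] by simp
next
  case (Suc n)
  have "int p ^ Suc n dvd (int (p ^ n))\<^sup>2"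
    using Suc.hyps by (simp flip: power_mult power_Suc add: le_imp_power_dvd)
  hence "[morita p (p * p ^ n) = morita p (p ^ n) ^ p] (mod int p ^ Suc n)"
    using cong_dvd_modulus[OF morita_mult_cong[OF assms(1) Suc.hyps assms(2), of p]] by blast
  also have "[morita p (p ^ n) ^ p = 1] (mod int p ^ Suc n)"
    using Suc by (intro power_prime_cong_1) auto
  finally show ?case by simp
qed

lemma morita_add_prime_power:
  assumes "prime p" "odd p"
  shows "[morita p (x + p ^ n) = morita p x] (mod int (p ^ n))"
proof (cases "n = 0")
  case True
  thus ?thesis by (simp add: cong_def)
next
  case False
  show ?thesis
  proof (induction x)
    case 0
    show ?case using False morita_prime_power[OF assms] by (simp add: morita_0)
  next
    case (Suc x)
    have "p dvd x + p ^ n \<longleftrightarrow> p dvd x"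
      using False by (simp add: dvd_add_left_iff dvd_power)
    moreover have "[- int (x + p ^ n) = - int x] (mod int (p ^ n))"
      by (simp add: cong_iff_dvd_diff)
    ultimately have "[(if p dvd x + p ^ n then - 1 else - int (x + p ^ n)) = (if p dvd x then - 1 else - int x)]
        (mod int (p ^ n))"
      by simp
    from cong_mult[OF Suc this] show ?case by (simp add: morita_Suc)
  qed
qed

text \<open>This is the p-adic uniform continuity of the gamma values at natural numbers, which
  permits their extension to the p-adic integers.\<close>

lemma morita_cong:
  assumes "prime p" "odd p" "[x = y] (mod p ^ n)"
  shows "[morita p x = morita p y] (mod int (p ^ n))"
proof -
  have *: "[morita p (x + k * p ^ n) = morita p x] (mod int (p ^ n))" for x k
  proof (induction k)
    case (Suc k)
    from morita_add_prime_power[OF assms(1,2), of "x + k * p ^ n" n] Suc show ?case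
      by (simp add: algebra_simps) (metis (no_types) cong_trans)
  qed simp
  have "\<exists>k. x = y + k * p ^ n \<or> y = x + k * p ^ n"
    using assms(3) by (metis cong_le_nat cong_sym mult.commute nat_le_linear add.commute)
  thus ?thesis using * cong_sym by blast
qed

text \<open>Gamma values are p-adic units, which allows the denominators to be cleared and
  restored.\<close>

lemma not_dvd_morita:
  assumes "prime p"
  shows "\<not> int p dvd morita p n"
  using assms by (induction n) (auto simp: morita_0 morita_Suc prime_dvd_mult_iff)

section \<open>Affine functions modulo the square of a prime\<close>

text \<open>The slopes carry a factor p, so a product of two linear parts vanishes modulo p^2. This
  closes the class under multiplication.\<close>

definition affine_mod_sq :: "nat \<Rightarrow> (nat \<Rightarrow> nat \<Rightarrow> int) \<Rightarrow> bool"
  where "affine_mod_sq p f \<longleftrightarrow>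
    (\<exists>u v w. \<forall>s t. [f s t = u + int p * (v * int s + w * int t)] (mod (int p)\<^sup>2))"

lemma affine_mod_sqI:
  assumes "\<And>s t. [f s t = u + int p * (v * int s + w * int t)] (mod (int p)\<^sup>2)"
  shows "affine_mod_sq p f"
  using assms unfolding affine_mod_sq_def by blast

lemma affine_mod_sq_const: "affine_mod_sq p (\<lambda>s t. c)"
  by (rule affine_mod_sqI[of _ c _ 0 0]) simp

lemma affine_mod_sq_linear: "affine_mod_sq p (\<lambda>s t. c + int p * (v * int s + w * int t))"
  by (rule affine_mod_sqI) (rule cong_refl)

lemma affine_mod_sq_cong:
  assumes "affine_mod_sq p g" "\<And>s t. [f s t = g s t] (mod (int p)\<^sup>2)"
  shows "affine_mod_sq p f"
  using assms unfolding affine_mod_sq_def by (meson cong_trans)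

lemma affine_mod_sq_add:
  assumes "affine_mod_sq p f" "affine_mod_sq p g"
  shows "affine_mod_sq p (\<lambda>s t. f s t + g s t)"
proof -
  from assms obtain u v w u' v' w' where
    f: "\<And>s t. [f s t = u + int p * (v * int s + w * int t)] (mod (int p)\<^sup>2)" and
    g: "\<And>s t. [g s t = u' + int p * (v' * int s + w' * int t)] (mod (int p)\<^sup>2)"
    unfolding affine_mod_sq_def by metis
  show ?thesis
  proof (rule affine_mod_sqI)
    fix s t
    show "[f s t + g s t = (u + u') + int p * ((v + v') * int s + (w + w') * int t)] (mod (int p)\<^sup>2)"
      using cong_add[OF f g, of s t s t] by (simp add: algebra_simps)
  qed
qed

lemma affine_mod_sq_mult:
  assumes "affine_mod_sq p f" "affine_mod_sq p g"
  shows "affine_mod_sq p (\<lambda>s t. f s t * g s t)"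
proof -
  from assms obtain u v w u' v' w' where
    f: "\<And>s t. [f s t = u + int p * (v * int s + w * int t)] (mod (int p)\<^sup>2)" and
    g: "\<And>s t. [g s t = u' + int p * (v' * int s + w' * int t)] (mod (int p)\<^sup>2)"
    unfolding affine_mod_sq_def by metis
  show ?thesis
  proof (rule affine_mod_sqI)
    fix s t
    let ?l = "v * int s + w * int t" and ?l' = "v' * int s + w' * int t"
    have "[f s t * g s t = (u + int p * ?l) * (u' + int p * ?l')] (mod (int p)\<^sup>2)"
      by (intro cong_mult f g)
    also have "(u + int p * ?l) * (u' + int p * ?l') =
        (u * u' + int p * ((u * v' + u' * v) * int s + (u * w' + u' * w) * int t)) + (int p)\<^sup>2 * (?l * ?l')"
      by (simp add: algebra_simps power2_eq_square)
    also have "[\<dots> = u * u' + int p * ((u * v' + u' * v) * int s + (u * w' + u' * w) * int t)] (mod (int p)\<^sup>2)"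
      by (simp add: cong_iff_dvd_diff)
    finally show "[f s t * g s t =
        u * u' + int p * ((u * v' + u' * v) * int s + (u * w' + u' * w) * int t)] (mod (int p)\<^sup>2)" .
  qed
qed

lemma affine_mod_sq_sum:
  assumes "finite A" "\<And>i. i \<in> A \<Longrightarrow> affine_mod_sq p (f i)"
  shows "affine_mod_sq p (\<lambda>s t. \<Sum>i\<in>A. f i s t)"
  using assms
  by (induction A rule: finite_induct) (auto intro: affine_mod_sq_const affine_mod_sq_add)

lemma affine_mod_sq_prod:
  assumes "finite A" "\<And>i. i \<in> A \<Longrightarrow> affine_mod_sq p (f i)"
  shows "affine_mod_sq p (\<lambda>s t. \<Prod>i\<in>A. f i s t)"
  using assms
  by (induction A rule: finite_induct) (auto intro: affine_mod_sq_const affine_mod_sq_mult)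

text \<open>An inverse of c modulo p^2 is a constant, hence itself affine. This serves to divide by
  k! for k < p.\<close>

lemma affine_mod_sq_cancel:
  assumes "affine_mod_sq p (\<lambda>s t. c * f s t)" "coprime c (int p)"
  shows "affine_mod_sq p f"
proof -
  have "coprime c ((int p)\<^sup>2)" using assms(2) by simp
  then obtain d where d: "[c * d = 1] (mod (int p)\<^sup>2)" using cong_solve_coprime_int by blast
  show ?thesis
  proof (rule affine_mod_sq_cong)
    show "affine_mod_sq p (\<lambda>s t. d * (c * f s t))"
      by (intro affine_mod_sq_mult affine_mod_sq_const assms)
    show "[f s t = d * (c * f s t)] (mod (int p)\<^sup>2)" for s t
      using cong_scalar_right[OF d, of "f s t"] by (simp add: cong_sym mult.assoc mult.left_commute)
  qed
qed

text \<open>The three values determine u, p * v and p * w modulo p^2, although v and w only modulo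
  p.\<close>

lemma affine_mod_sq_eq_0:
  assumes "affine_mod_sq p f" "f 0 0 = 0" "f 1 0 = 0" "f 0 1 = 0"
  shows "[f s t = 0] (mod (int p)\<^sup>2)"
proof -
  from assms obtain u v w where
    f: "\<And>s t. [f s t = u + int p * (v * int s + w * int t)] (mod (int p)\<^sup>2)"
    unfolding affine_mod_sq_def by blast
  have u: "(int p)\<^sup>2 dvd u" and "(int p)\<^sup>2 dvd u + int p * v" "(int p)\<^sup>2 dvd u + int p * w"
    using f[of 0 0] f[of 1 0] f[of 0 1] assms(2-4)
    by (simp_all add: cong_0_iff cong_sym_eq[of 0])
  hence "(int p)\<^sup>2 dvd int p * v" "(int p)\<^sup>2 dvd int p * w"
    by (simp_all only: dvd_add_right_iff[OF u])
  hence "(int p)\<^sup>2 dvd u + ((int p * v) * int s + (int p * w) * int t)"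
    using u by (auto intro: dvd_mult2)
  hence "[u + int p * (v * int s + w * int t) = 0] (mod (int p)\<^sup>2)"
    by (simp add: cong_0_iff algebra_simps)
  with f show ?thesis by (rule cong_trans)
qed

section \<open>Gamma values and binomial coefficients as affine functions modulo p^2\<close>

lemma morita_add:
  "morita p (n + c) = morita p n * (\<Prod>l<c. if p dvd n + l then - 1 else - int (n + l))"
  by (induction c) (simp_all add: morita_Suc)

text \<open>By Wilson's theorem Gamma_p(p) = 1 + p c, and (1 + p c)^k is congruent to 1 + k p c
  modulo p^2.\<close>

lemma morita_mult_prime:
  assumes "prime p" "odd p"
  shows "[morita p (p * k) = 1 + int k * (morita p p - 1)] (mod (int p)\<^sup>2)"
proof -
  obtain c where c: "morita p p - 1 = int p * c"
    using morita_prime[OF assms(1)] by (auto simp: cong_iff_dvd_diff)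
  have "[morita p (p * k) = morita p p ^ k] (mod (int p)\<^sup>2)"
    using morita_mult_cong[of p 1 k] assms by (simp add: mult.commute)
  also have "[morita p p ^ k = 1 + int k * (morita p p - 1)] (mod (int p)\<^sup>2)"
  proof (induction k)
    case (Suc k)
    have "[morita p p ^ Suc k = (1 + int p * c) * (1 + int k * (int p * c))] (mod (int p)\<^sup>2)"
      using cong_scalar_left[OF Suc, of "morita p p"] c by (simp add: algebra_simps)
    also have "(1 + int p * c) * (1 + int k * (int p * c)) =
        1 + int (Suc k) * (int p * c) + (int p)\<^sup>2 * (int k * c\<^sup>2)"
      by (simp add: algebra_simps power2_eq_square)
    also have "[\<dots> = 1 + int (Suc k) * (int p * c)] (mod (int p)\<^sup>2)"
      by (simp add: cong_iff_dvd_diff)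
    finally show ?case by (simp add: c)
  qed simp
  finally show ?thesis .
qed

text \<open>The coefficients \<open>i\<close> and \<open>j\<close> let one statement cover the
  arguments p s, p t and p (s + t). Whether p divides the index of a factor depends only on the
  offset \<open>l\<close>, so each factor after the first p (i s + j t) is either the constant -1 or
  affine.\<close>

lemma affine_mod_sq_morita:
  assumes "prime p" "odd p"
  shows "affine_mod_sq p (\<lambda>s t. morita p (p * (i * s + j * t) + c))"
proof -
  obtain d where d: "morita p p - 1 = int p * d"
    using morita_prime[OF assms(1)] by (auto simp: cong_iff_dvd_diff)
  have "affine_mod_sq p (\<lambda>s t. morita p (p * (i * s + j * t)))"
  proof (rule affine_mod_sqI[of _ 1 _ "int i * d" "int j * d"])
    fix s t
    show "[morita p (p * (i * s + j * t)) = 1 + int p * (int i * d * int s + int j * d * int t)]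
        (mod (int p)\<^sup>2)"
      using morita_mult_prime[OF assms, of "i * s + j * t"] d by (simp add: algebra_simps)
  qed
  moreover have "affine_mod_sq p (\<lambda>s t. if p dvd p * (i * s + j * t) + l then - 1
      else - int (p * (i * s + j * t) + l))" for l
  proof (cases "p dvd l")
    case True
    thus ?thesis by (simp add: affine_mod_sq_const)
  next
    case False
    hence "\<not> p dvd p * k + l" for k by (simp add: dvd_add_right_iff)
    moreover have "- int (p * (i * s + j * t) + l) = - int l + int p * (- int i * int s + - int j * int t)" for s t
      by (simp add: algebra_simps)
    ultimately show ?thesis by (simp only: if_False affine_mod_sq_linear)
  qed
  ultimately show ?thesis
    unfolding morita_add by (intro affine_mod_sq_mult affine_mod_sq_prod) auto
qed

text \<open>Stated without division, so that it applies both to the integers and to the p-adic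
  integers.\<close>

lemma pochhammer_minus_of_nat:
  "pochhammer (- of_nat m :: 'a::comm_ring_1) k = (- 1) ^ k * (of_nat (fact k) * of_nat (m choose k))"
proof (induction k)
  case (Suc k)
  have "Suc k * (m choose Suc k) = (m - k) * (m choose k)"
    by (metis binomial_absorb_comp binomial_absorption)
  hence "of_nat (Suc k) * of_nat (m choose Suc k) = (of_nat (m - k) * of_nat (m choose k) :: 'a)"
    by (metis of_nat_mult)
  also have "\<dots> = (of_nat m - of_nat k) * of_nat (m choose k)"
    by (cases "k \<le> m") (auto simp: of_nat_diff binomial_eq_0)
  finally have *: "of_nat (Suc k) * of_nat (m choose Suc k) = (of_nat m - of_nat k) * (of_nat (m choose k) :: 'a)" .
  have "pochhammer (- of_nat m :: 'a) (Suc k) =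
      (- 1) ^ Suc k * of_nat (fact k) * ((of_nat m - of_nat k) * of_nat (m choose k))"
    unfolding pochhammer_Suc Suc.IH by (simp add: algebra_simps)
  also have "\<dots> = (- 1) ^ Suc k * (of_nat (fact (Suc k)) * of_nat (m choose Suc k))"
    unfolding *[symmetric] fact_Suc of_nat_mult by (simp only: of_nat_id ac_simps)
  finally show ?case .
qed simp

lemma coprime_fact:
  fixes p :: nat
  assumes "prime p" "k < p"
  shows "coprime (fact k) p"
  using assms prime_imp_coprime[of p "fact k"] by (auto simp: prime_dvd_fact_iff coprime_commute)

text \<open>Up to sign, k! times the binomial coefficient is a product of affine factors -n + l, and
  k! is prime to p because k < p.\<close>

lemma affine_mod_sq_binomial:
  assumes "prime p" "k < p"
  shows "affine_mod_sq p (\<lambda>s t. int ((p * (i * s + j * t) + c) choose k))"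
proof (rule affine_mod_sq_cancel)
  have "(- 1) ^ k * fact k * int (n choose k) = (\<Prod>l<k. - int n + int l)" for n
    using pochhammer_minus_of_nat[of n k, where ?'a = int]
    by (simp add: pochhammer_prod lessThan_atLeast0 mult.assoc)
  moreover have "affine_mod_sq p (\<lambda>s t. - int (p * (i * s + j * t) + c) + int l)" for l
    using affine_mod_sq_linear[of p "int l - int c" "- int i" "- int j"] by (simp add: algebra_simps)
  ultimately show "affine_mod_sq p (\<lambda>s t. (- 1) ^ k * fact k * int ((p * (i * s + j * t) + c) choose k))"
    by (simp only:) (intro affine_mod_sq_prod; simp)
  have "coprime (int (fact k)) (int p)"
    using coprime_fact[OF assms] by (simp only: coprime_int_iff)
  thus "coprime ((- 1) ^ k * fact k) (int p)"
    by (simp add: coprime_mult_left_iff)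
qed

text \<open>The second assumption compares the contributions of the multiples of \<open>p\<close> to the factorials.\<close>

lemma morita_mult_binomial:
  assumes "p > 0"
    and "int (p ^ ((m + n) div p) * fact ((m + n) div p)) =
      - e * int (p ^ (m div p) * fact (m div p)) * int (p ^ (n div p) * fact (n div p))"
  shows "morita p (Suc m) * morita p (Suc n) * int ((m + n) choose n) = e * morita p (Suc (m + n))"
proof -
  define A where "A = (\<lambda>n. int (p ^ (n div p) * fact (n div p)))"
  have fact: "fact n = (- 1) ^ Suc n * morita p (Suc n) * A n" for n
    using fact_eq_morita[OF assms(1), of n] by (simp add: A_def algebra_simps)
  have A: "A (m + n) = - e * A m * A n"
    using assms(2) by (simp only: A_def)
  have "fact m * fact n * ((m + n) choose n) = (fact (m + n) :: nat)"
    using binomial_fact_lemma[of n "m + n"] by (simp add: mult.commute)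
  hence "int (fact m * fact n * ((m + n) choose n)) = int (fact (m + n))"
    by (simp only:)
  hence "fact m * fact n * int ((m + n) choose n) = fact (m + n)"
    by (simp only: of_nat_mult of_nat_fact)
  hence "(- 1) ^ (m + n) * (A m * A n) * (morita p (Suc m) * morita p (Suc n) * int ((m + n) choose n)) =
      (- 1) ^ (m + n) * (A m * A n) * (e * morita p (Suc (m + n)))"
    unfolding fact A by (simp add: power_add ac_simps)
  moreover have "A m * A n \<noteq> 0" using assms(1) by (simp add: A_def)
  ultimately show ?thesis by simp
qed

text \<open>Terms with k > n vanish, so \<open>n < p\<close> makes the truncated sum the whole
  Vandermonde sum.\<close>

lemma sum_binomial_mult_binomial:
  assumes "n < p"
  shows "(\<Sum>k<p. (m choose k) * (n choose k)) = (m + n) choose n"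
proof -
  have "(\<Sum>k<p. (m choose k) * (n choose k)) = (\<Sum>k\<le>n. (m choose k) * (n choose k))"
    using assms by (intro sum.mono_neutral_right) (auto simp: binomial_eq_0)
  also have "\<dots> = (\<Sum>k\<le>n. (m choose k) * (n choose (n - k)))"
    by (intro sum.cong arg_cong2[where f = "(*)"] binomial_symmetric) simp_all
  finally show ?thesis by (simp add: vandermonde)
qed

lemma sum_binomial_mult_morita_cong:
  fixes a b p s t :: nat
  assumes "prime p" "odd p" "a < p" "b < p"
  defines "m \<equiv> p * s + a" and "n \<equiv> p * t + b"
  defines "e \<equiv> if a + b < p then - 1 else - (int p * int (s + t + 1))"
  shows "[morita p (Suc m) * morita p (Suc n) * int (\<Sum>k<p. (m choose k) * (n choose k)) =
      e * morita p (Suc (m + n))] (mod (int p)\<^sup>2)"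
proof -
  define E where "E = (\<lambda>s t. if a + b < p then - 1 else - (int p * int (s + t + 1)))"
  \<comment> \<open>The difference of the two sides as a function of (s, t), written with
    \<open>- 1 *\<close> and with casts inside the sum to match the closure rules for affine
    functions.\<close>
  define D where "D = (\<lambda>s t. morita p (p * s + Suc a) * morita p (p * t + Suc b) *
      (\<Sum>k<p. int ((p * s + a) choose k) * int ((p * t + b) choose k)) +
      - 1 * E s t * morita p (p * (s + t) + Suc (a + b)))"
  have "p > 0" using assms(3) by simp
  have M: "affine_mod_sq p (\<lambda>s t. morita p (p * s + c))" "affine_mod_sq p (\<lambda>s t. morita p (p * t + c))"
    "affine_mod_sq p (\<lambda>s t. morita p (p * (s + t) + c))" for c
    using affine_mod_sq_morita[OF assms(1,2), of 1 0 c] affine_mod_sq_morita[OF assms(1,2), of 0 1 c]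
      affine_mod_sq_morita[OF assms(1,2), of 1 1 c] by simp_all
  have C: "affine_mod_sq p (\<lambda>s t. int ((p * s + c) choose k))"
    "affine_mod_sq p (\<lambda>s t. int ((p * t + c) choose k))" if "k < p" for c k
    using affine_mod_sq_binomial[OF assms(1) that, of 1 0 c]
      affine_mod_sq_binomial[OF assms(1) that, of 0 1 c] by simp_all
  have "- (int p * int (s + t + 1)) = - int p + int p * (- 1 * int s + - 1 * int t)" for s t
    by (simp add: algebra_simps)
  hence "affine_mod_sq p E"
    unfolding E_def by (cases "a + b < p") (simp_all only: if_True if_False affine_mod_sq_const affine_mod_sq_linear)
  hence "affine_mod_sq p D"
    unfolding D_def
    by (intro affine_mod_sq_add affine_mod_sq_mult affine_mod_sq_sum affine_mod_sq_const M C) auto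
  have D: "D s t = morita p (Suc (p * s + a)) * morita p (Suc (p * t + b)) *
      int (\<Sum>k<p. ((p * s + a) choose k) * ((p * t + b) choose k)) -
      E s t * morita p (Suc ((p * s + a) + (p * t + b)))" for s t
    by (simp add: D_def algebra_simps)
  \<comment> \<open>The second condition will hold at the three points because (s + t)! = s! t! when
    s or t is 0; a carry adds exactly the factor p (s + t + 1), which is
    \<open>- E s t\<close>.\<close>
  have exact: "D s t = 0"
    if "s = 0 \<or> t = 0" and "int (p ^ (((p * s + a) + (p * t + b)) div p) * fact (((p * s + a) + (p * t + b)) div p)) =
      - E s t * int (p ^ s * fact s) * int (p ^ t * fact t)" for s t
  proof -
    have "(p * s + a) div p = s" "(p * t + b) div p = t" using assms(3,4) \<open>p > 0\<close> by auto
    hence *: "morita p (Suc (p * s + a)) * morita p (Suc (p * t + b)) * int (((p * s + a) + (p * t + b)) choose (p * t + b)) =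
        E s t * morita p (Suc ((p * s + a) + (p * t + b)))"
      using that(2) \<open>p > 0\<close> by (intro morita_mult_binomial) simp_all
    have "(\<Sum>k<p. ((p * s + a) choose k) * ((p * t + b) choose k)) =
        ((p * s + a) + (p * t + b)) choose (p * t + b)"
      using that(1)
    proof
      assume "t = 0"
      thus ?thesis using sum_binomial_mult_binomial[of b p "p * s + a"] assms(4) by simp
    next
      assume "s = 0"
      thus ?thesis
        using sum_binomial_mult_binomial[of a p "p * t + b"] assms(3)
          binomial_symmetric[of a "p * t + b + a"] by (simp add: mult.commute add.commute)
    qed
    with * show ?thesis unfolding D by simp
  qed
  \<comment> \<open>The 0 or 1 is the carry from adding the last base-p digits a and b.\<close>
  have div: "(p * i + (a + b)) div p = i + (if a + b < p then 0 else 1)" for i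
  proof (cases "a + b < p")
    case False
    hence "(a + b) div p = 1" using assms(3,4) by (intro div_nat_eqI) auto
    thus ?thesis using \<open>p > 0\<close> False by simp
  qed (use \<open>p > 0\<close> in simp)
  have "D 0 0 = 0" using div[of 0] by (intro exact) (auto simp: E_def)
  moreover have "D 1 0 = 0" using div[of 1] by (intro exact) (auto simp: E_def ac_simps)
  moreover have "D 0 1 = 0" using div[of 1] by (intro exact) (auto simp: E_def ac_simps)
  ultimately have "[D s t = 0] (mod (int p)\<^sup>2)" by (intro affine_mod_sq_eq_0 \<open>affine_mod_sq p D\<close>)
  thus ?thesis
    unfolding D m_def n_def e_def E_def by (simp add: cong_diff_iff_cong_0)
qed

section \<open>Approximation in the ring of p-adic integers\<close>

lemma Rep_of_int:
  "Rep_padic_int (of_int k :: 'p padic_int) n = k mod int CARD('p::prime_card) ^ n"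
proof (cases "k \<ge> 0")
  case True
  thus ?thesis using Rep_of_nat[of "nat k" n, where ?'p = 'p] by simp
next
  case False
  hence "(of_int k :: 'p padic_int) = 0 - of_nat (nat (- k))" by simp
  thus ?thesis using False by (simp only: Rep_minus Rep_zero Rep_of_nat) (simp add: mod_simps)
qed

lemma Rep_less: "Rep_padic_int (x :: 'p padic_int) n < int CARD('p::prime_card) ^ n"
  and Rep_nonneg: "0 \<le> Rep_padic_int x n"
  and Rep_Suc: "Rep_padic_int x (Suc n) mod int CARD('p) ^ n = Rep_padic_int x n"
  using Rep_padic_int[of x] by auto

text \<open>If the n-th entry is 0, then p^n divides every later entry; the quotient is the sequence
  shifted by n places and divided by p^n.\<close>

lemma padic_power_dvd_iff:
  "of_nat CARD('p) ^ n dvd (x :: 'p::prime_card padic_int) \<longleftrightarrow> Rep_padic_int x n = 0"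
proof
  assume "of_nat CARD('p) ^ n dvd x"
  then obtain z where "x = of_nat (CARD('p) ^ n) * z" by (auto elim: dvdE)
  thus "Rep_padic_int x n = 0"
    by (simp only: Rep_times Rep_of_nat) simp
next
  let ?q = "int CARD('p)"
  assume x: "Rep_padic_int x n = 0"
  define z where "z = (\<lambda>k. Rep_padic_int x (n + k) div ?q ^ n)"
  have "?q ^ n dvd Rep_padic_int x (n + k)" for k
    using Rep_mod[of x n k] x by (simp add: mod_eq_0_iff_dvd)
  hence z: "Rep_padic_int x (n + k) = ?q ^ n * z k" for k by (simp add: z_def)
  have q: "?q > 0" by (rule CARD_prime_card_pos)
  have "z k \<in> {0..<?q ^ k}" for k
    using Rep_nonneg[of x "n + k"] Rep_less[of x "n + k"] zero_less_power[OF q, of n] unfolding z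
    by (auto simp: power_add zero_le_mult_iff)
  moreover have "z (Suc k) mod ?q ^ k = z k" for k
    using Rep_Suc[of x "n + k"] q unfolding add_Suc_right[symmetric] z power_add
    by (simp only: mult_mod_right[symmetric]) simp
  ultimately have Rz: "Rep_padic_int (Abs_padic_int z :: 'p padic_int) = z"
    by (intro Abs_padic_int_inverse) auto
  have "x = of_nat (CARD('p) ^ n) * Abs_padic_int z"
  proof (rule Rep_padic_int_inject[THEN iffD1], rule ext)
    fix k
    have "?q ^ n * z k mod ?q ^ k = Rep_padic_int x k"
      using Rep_mod[of x k n] z[of k] by (simp add: add.commute)
    thus "Rep_padic_int x k = Rep_padic_int (of_nat (CARD('p) ^ n) * Abs_padic_int z :: 'p padic_int) k"
      by (simp only: Rep_times Rep_of_nat Rz) (simp add: mod_simps)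
  qed
  thus "of_nat CARD('p) ^ n dvd x" by simp
qed

lemma padic_power_dvd_diff_iff:
  "of_nat CARD('p) ^ n dvd (x - y :: 'p::prime_card padic_int) \<longleftrightarrow> Rep_padic_int x n = Rep_padic_int y n"
proof -
  have "Rep_padic_int z n mod int CARD('p) ^ n = Rep_padic_int z n" for z :: "'p padic_int"
    using Rep_less[of z n] Rep_nonneg[of z n] by simp
  thus ?thesis
    unfolding padic_power_dvd_iff Rep_minus
    by (metis mod_eq_0_iff_dvd mod_eq_dvd_iff)
qed

lemma padic_power_dvd_of_int_diff_iff:
  "of_nat CARD('p) ^ n dvd (of_int i - of_int j :: 'p::prime_card padic_int) \<longleftrightarrow>
    [i = j] (mod int (CARD('p) ^ n))"
  unfolding padic_power_dvd_diff_iff Rep_of_int by (simp add: cong_def)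

lemma padic_power_dvd_of_nat_diff_iff:
  "of_nat CARD('p) ^ n dvd (of_nat i - of_nat j :: 'p::prime_card padic_int) \<longleftrightarrow> [i = j] (mod CARD('p) ^ n)"
  using padic_power_dvd_of_int_diff_iff[of n "int i" "int j", where ?'p = 'p]
  by (simp only: of_int_of_nat_eq cong_int_iff)

lemma padic_approx_of_nat:
  obtains m where "of_nat CARD('p) ^ n dvd (x - of_nat m :: 'p::prime_card padic_int)"
proof
  show "of_nat CARD('p) ^ n dvd (x - of_nat (nat (Rep_padic_int x n)) :: 'p padic_int)"
    unfolding padic_power_dvd_diff_iff Rep_of_nat using Rep_nonneg[of x n] Rep_less[of x n] by simp
qed

text \<open>The entries can be inverted modulo each p^n; uniqueness of inverses makes the chosen
  representatives coherent.\<close>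

lemma padic_unit:
  assumes "\<not> of_nat CARD('p) dvd (x :: 'p::prime_card padic_int)"
  shows "x dvd 1"
proof -
  let ?q = "int CARD('p)"
  have "Rep_padic_int x n mod ?q = Rep_padic_int x 1" if "n > 0" for n
    using Rep_mod[of x 1 "n - 1"] that by simp
  moreover have "Rep_padic_int x 1 \<noteq> 0"
    using assms padic_power_dvd_iff[of 1 x] by simp
  ultimately have "\<not> ?q dvd Rep_padic_int x n" if "n > 0" for n
    using that by (metis dvd_imp_mod_0)
  hence cop: "coprime (Rep_padic_int x n) (?q ^ n)" for n
    using prime_imp_coprime[of ?q] prime_card[where ?'a = 'p]
    by (cases "n > 0") (auto simp: coprime_commute)
  have q: "?q ^ n > 0" for n using CARD_prime_card_pos[where ?'p = 'p] by simp
  have "\<exists>y. 0 \<le> y \<and> y < ?q ^ n \<and> [Rep_padic_int x n * y = 1] (mod ?q ^ n)" for n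
  proof -
    obtain y where "[Rep_padic_int x n * y = 1] (mod ?q ^ n)"
      using cong_solve_coprime_int[OF cop] by blast
    thus ?thesis using q[of n] by (intro exI[of _ "y mod ?q ^ n"]) (simp add: cong_def mod_simps)
  qed
  then obtain y where y: "\<And>n. 0 \<le> y n" "\<And>n. y n < ?q ^ n" "\<And>n. [Rep_padic_int x n * y n = 1] (mod ?q ^ n)"
    by metis
  have "y (Suc n) mod ?q ^ n = y n" for n
  proof -
    have "[Rep_padic_int x (Suc n) * y (Suc n) = 1] (mod ?q ^ n)"
      using y(3)[of "Suc n"] by (rule cong_dvd_modulus) simp
    moreover have "[Rep_padic_int x (Suc n) = Rep_padic_int x n] (mod ?q ^ n)"
      using Rep_Suc[of x n] by (metis cong_def mod_mod_trivial)
    ultimately have "[Rep_padic_int x n * y (Suc n) = Rep_padic_int x n * y n] (mod ?q ^ n)"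
      using y(3)[of n] by (meson cong_scalar_right cong_sym cong_trans)
    hence "[y (Suc n) = y n] (mod ?q ^ n)" using cop cong_mult_lcancel by blast
    thus ?thesis using y(1,2)[of n] by (simp add: cong_def)
  qed
  hence Ry: "Rep_padic_int (Abs_padic_int y :: 'p padic_int) = y"
    using y by (intro Abs_padic_int_inverse) auto
  have "x * Abs_padic_int y = 1"
  proof (rule Rep_padic_int_inject[THEN iffD1], rule ext)
    show "Rep_padic_int (x * Abs_padic_int y) n = Rep_padic_int (1 :: 'p padic_int) n" for n
      using y(3)[of n] Rep_of_nat[of 1 n, where ?'p = 'p] by (simp add: Rep_times Ry cong_def)
  qed
  thus ?thesis by (metis dvd_triv_left)
qed

section \<open>Density of the natural numbers and 1-Lipschitz maps\<close>

lemma dist_padic_int_le: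
  assumes "of_nat CARD('p) ^ n dvd (x - y :: 'p::prime_card padic_int)"
  shows "dist x y \<le> inverse (real CARD('p)) ^ n"
proof (cases "x = y")
  case False
  hence "n \<le> padic_val (x - y)" using assms by (intro padic_val_ge) auto
  moreover have "0 \<le> inverse (real CARD('p))" "inverse (real CARD('p)) \<le> 1"
    using prime_gt_0_nat[OF prime_card[where ?'a = 'p]] by (auto simp: field_simps)
  ultimately show ?thesis
    using False unfolding dist_padic_int_def by (simp add: power_decreasing del: power_inverse)
qed (simp add: dist_padic_int_def)

lemma closure_range_of_nat_padic: "closure (range of_nat) = (UNIV :: 'p::prime_card padic_int set)"
proof -
  have "x \<in> closure (range of_nat)" for x :: "'p padic_int"
    unfolding closure_approachable
  proof (intro allI impI)
    fix e :: real assume "e > 0"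
    have "inverse (real CARD('p)) < 1"
      using prime_gt_1_nat[OF prime_card[where ?'a = 'p]] by (simp add: field_simps)
    then obtain n where n: "inverse (real CARD('p)) ^ n < e"
      using real_arch_pow_inv[OF \<open>e > 0\<close>] by blast
    obtain m where "of_nat CARD('p) ^ n dvd (x - of_nat m)" by (rule padic_approx_of_nat)
    hence "dist x (of_nat m) < e" using dist_padic_int_le n by fastforce
    thus "\<exists>y\<in>range of_nat. dist y x < e" by (auto simp: dist_commute)
  qed
  thus ?thesis by auto
qed

text \<open>A map preserving congruences modulo every p^n does not increase distances.\<close>

lemma continuous_on_padicI:
  fixes f :: "'p::prime_card padic_int \<Rightarrow> 'p padic_int"
  assumes "\<And>n x y. of_nat CARD('p) ^ n dvd x - y \<Longrightarrow> of_nat CARD('p) ^ n dvd f x - f y"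
  shows "continuous_on UNIV f"
  unfolding continuous_on_iff
proof (intro ballI allI impI)
  fix x :: "'p padic_int" and e :: real
  assume "e > 0"
  have "dist (f y) (f x) \<le> dist y x" for y
  proof (cases "x = y")
    case False
    hence "of_nat CARD('p) ^ padic_val (y - x) dvd f y - f x"
      by (intro assms padic_val_dvd) simp
    from dist_padic_int_le[OF this] show ?thesis using False by (auto simp: dist_padic_int_def)
  qed simp
  thus "\<exists>d>0. \<forall>x'\<in>UNIV. dist x' x < d \<longrightarrow> dist (f x') (f x) < e"
    using \<open>e > 0\<close> by (meson le_less_trans)
qed

section \<open>The gamma function on the p-adic integers\<close>

lemma padic_Gamma_nat_eq_morita:
  "padic_Gamma_nat n = (of_int (morita CARD('p) n) :: 'p::prime_card padic_int)"
proof (induction n)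
  case 0
  show ?case by (simp add: padic_Gamma_nat_def morita_0)
next
  case (Suc n)
  have *: "{j. 1 \<le> j \<and> j < Suc n \<and> \<not> CARD('p) dvd j} =
      (if CARD('p) dvd n then {} else {n}) \<union> {j. 1 \<le> j \<and> j < n \<and> \<not> CARD('p) dvd j}"
    by (auto simp: less_Suc_eq Suc_le_eq intro: Nat.gr0I)
  have "finite {j. 1 \<le> j \<and> j < n \<and> \<not> CARD('p) dvd j}" by simp
  hence "(padic_Gamma_nat (Suc n) :: 'p padic_int) =
      padic_Gamma_nat n * (if CARD('p) dvd n then - 1 else - of_nat n)"
    unfolding padic_Gamma_nat_def * by auto
  thus ?case using Suc by (simp add: morita_Suc)
qed

text \<open>The extension \<open>f\<close> is built from residues: modulo p^n its value at x is the
  gamma value at the natural number representing x modulo p^n, and \<open>morita_cong\<close> makes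
  these residues coherent. Density of the natural numbers gives uniqueness, which resolves the
  definite description. The second claim is read off from \<open>f\<close> and is more precise than
  continuity.\<close>

lemma padic_Gamma:
  assumes "odd CARD('p)"
  shows padic_Gamma_of_nat: "padic_Gamma (of_nat n) = (padic_Gamma_nat n :: 'p::prime_card padic_int)"
    and padic_Gamma_dvd_diff: "of_nat CARD('p) ^ k dvd (x - y :: 'p padic_int) \<Longrightarrow>
      of_nat CARD('p) ^ k dvd padic_Gamma x - padic_Gamma y"
proof -
  let ?q = "int CARD('p)"
  let ?P = "\<lambda>f :: 'p padic_int \<Rightarrow> 'p padic_int. continuous_on UNIV f \<and> (\<forall>n. f (of_nat n) = padic_Gamma_nat n)"
  define g where "g = (\<lambda>(x :: 'p padic_int) n. morita CARD('p) (nat (Rep_padic_int x n)) mod ?q ^ n)"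
  define f where "f = (\<lambda>x. Abs_padic_int (g x) :: 'p padic_int)"
  have mor: "morita CARD('p) i mod ?q ^ n = morita CARD('p) j mod ?q ^ n"
    if "int i mod ?q ^ n = int j mod ?q ^ n" for i j n
  proof -
    have "int (i mod CARD('p) ^ n) = int (j mod CARD('p) ^ n)"
      using that by (simp only: of_nat_mod of_nat_power)
    hence "[i = j] (mod CARD('p) ^ n)" by (simp add: cong_def)
    from morita_cong[OF prime_card assms this] show ?thesis by (simp add: cong_def)
  qed
  have "g x n \<in> {0..<?q ^ n}" for x n
    using CARD_prime_card_pos[where ?'p = 'p] by (simp add: g_def)
  moreover have "g x (Suc n) mod ?q ^ n = g x n" for x n
    unfolding g_def mod_power_Suc_mod
    by (rule mor) (use Rep_nonneg[of x] Rep_Suc[of x n] Rep_less[of x n] in simp)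
  ultimately have Rf: "Rep_padic_int (f x) = g x" for x
    unfolding f_def by (intro Abs_padic_int_inverse) auto
  have f_dvd: "of_nat CARD('p) ^ k dvd f x - f y" if "of_nat CARD('p) ^ k dvd x - y" for k x y
    using that unfolding padic_power_dvd_diff_iff Rf g_def by simp
  have "f (of_nat n) = padic_Gamma_nat n" for n
  proof (rule Rep_padic_int_inject[THEN iffD1], rule ext)
    show "Rep_padic_int (f (of_nat n)) k = Rep_padic_int (padic_Gamma_nat n :: 'p padic_int) k" for k
      unfolding Rf padic_Gamma_nat_eq_morita Rep_of_int g_def Rep_of_nat
      by (rule mor) (use CARD_prime_card_pos[where ?'p = 'p] in simp)
  qed
  moreover have "continuous_on UNIV f" using f_dvd by (rule continuous_on_padicI)
  ultimately have f: "?P f" by blast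
  have "h = f" if "?P h" for h
  proof -
    have "closed {x. h x = f x}" using f that by (intro closed_Collect_eq) auto
    moreover have "range of_nat \<subseteq> {x. h x = f x}" using f that by auto
    ultimately have "closure (range of_nat) \<subseteq> {x. h x = f x}" by (rule closure_minimal[rotated])
    thus ?thesis by (auto simp: closure_range_of_nat_padic)
  qed
  hence "padic_Gamma = f" unfolding padic_Gamma_def using f by (intro the_equality)
  with f f_dvd show "padic_Gamma (of_nat n) = (padic_Gamma_nat n :: 'p padic_int)"
    "of_nat CARD('p) ^ k dvd (x - y :: 'p padic_int) \<Longrightarrow>
      of_nat CARD('p) ^ k dvd padic_Gamma x - padic_Gamma y" by blast+
qed

lemma padic_residue:
  shows padic_residue_less: "padic_residue (x :: 'p::prime_card padic_int) < CARD('p)"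
    and padic_residue_dvd: "of_nat CARD('p) dvd x - of_nat (padic_residue x)"
proof -
  let ?Q = "\<lambda>r. r < CARD('p) \<and> of_nat CARD('p) dvd x - of_nat r"
  obtain m where m: "of_nat CARD('p) ^ 1 dvd x - of_nat m" by (rule padic_approx_of_nat)
  have "CARD('p) > 0" using prime_gt_0_nat[OF prime_card] .
  have iff: "of_nat CARD('p) dvd x - of_nat r \<longleftrightarrow> [m = r] (mod CARD('p))" for r
    using m padic_power_dvd_of_nat_diff_iff[of 1 m r, where ?'p = 'p]
      padic_power_dvd_diff_iff[of 1 x] padic_power_dvd_diff_iff[of 1 "of_nat m :: 'p padic_int"] by simp
  have "?Q r \<longleftrightarrow> r = m mod CARD('p)" for r
    unfolding iff using \<open>CARD('p) > 0\<close> by (auto simp: cong_def)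
  hence "\<exists>!r. ?Q r" by simp
  from theI'[OF this] show "padic_residue x < CARD('p)" "of_nat CARD('p) dvd x - of_nat (padic_residue x)"
    unfolding padic_residue_def by blast+
qed

section \<open>The supercongruence\<close>

lemma dvd_mult_diff_mult:
  fixes x y x' y' q :: "'a::comm_ring_1"
  assumes "q dvd x - x'" "q dvd y - y'"
  shows "q dvd x * y - x' * y'"
proof -
  have "x * y - x' * y' = (x - x') * y + x' * (y - y')" by (simp add: algebra_simps)
  thus ?thesis using assms by simp
qed

lemma dvd_pochhammer_diff:
  fixes x y q :: "'a::comm_ring_1"
  assumes "q dvd x - y"
  shows "q dvd pochhammer x k - pochhammer y k"
proof (induction k)
  case (Suc k)
  thus ?case
    unfolding pochhammer_Suc using assms by (intro dvd_mult_diff_mult) simp_all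
qed simp

lemma to_fract_of_nat: "to_fract (of_nat n) = of_nat n"
  by (induction n) simp_all

lemma to_fract_pochhammer: "to_fract (pochhammer x n) = pochhammer (to_fract x) n"
  by (induction n) (simp_all add: pochhammer_Suc to_fract_of_nat)

lemma padic_residue_decompose:
  fixes x :: "'p::prime_card padic_int"
  obtains s where "of_nat CARD('p) ^ n dvd x - of_nat (CARD('p) * s + padic_residue x)"
proof -
  \<comment> \<open>One extra power of p, so that the approximation fixes the residue modulo p even
    for n = 0.\<close>
  obtain m where m: "of_nat CARD('p) ^ Suc n dvd x - of_nat m" by (rule padic_approx_of_nat)
  hence "of_nat CARD('p) dvd x - of_nat m" by (rule dvd_trans[rotated]) simp
  hence "of_nat CARD('p) ^ 1 dvd of_nat m - (of_nat (padic_residue x) :: 'p padic_int)"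
    using dvd_diff[OF padic_residue_dvd[of x], of "x - of_nat m"] by simp
  hence "m mod CARD('p) = padic_residue x"
    unfolding padic_power_dvd_of_nat_diff_iff using padic_residue_less[of x] by (simp add: cong_def)
  hence "m = CARD('p) * (m div CARD('p)) + padic_residue x"
    by (metis mult_div_mod_eq)
  moreover have "of_nat CARD('p) ^ n dvd x - of_nat m"
    using m by (rule dvd_trans[rotated]) simp
  ultimately show ?thesis using that by metis
qed

text \<open>For k < p the factorial k! is a p-adic unit, so the series lies in the p-adic integers
  and respects congruences of its parameters. The signs (-1)^k from the two Pochhammer symbols
  cancel.\<close>

lemma hypergeo_trunc_padic:
  fixes \<alpha> \<beta> :: "'p::prime_card padic_int"
  assumes "of_nat CARD('p) ^ d dvd - \<alpha> - of_nat m" "of_nat CARD('p) ^ d dvd - \<beta> - of_nat n"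
  obtains S where "hypergeo_trunc [to_fract \<alpha>, to_fract \<beta>] [1] 1 (CARD('p) - 1) = to_fract S"
    "of_nat CARD('p) ^ d dvd S - of_nat (\<Sum>k<CARD('p). (m choose k) * (n choose k))"
proof -
  let ?P = "of_nat CARD('p) :: 'p padic_int"
  have "(of_nat (fact k) :: 'p padic_int) dvd 1" if "k < CARD('p)" for k
  proof (rule padic_unit)
    have "\<not> CARD('p) dvd fact k" using that prime_card prime_dvd_fact_iff by (metis not_le)
    thus "\<not> ?P dvd of_nat (fact k)"
      using padic_power_dvd_of_nat_diff_iff[of 1 "fact k" 0, where ?'p = 'p]
      by (simp add: cong_0_iff del: of_nat_fact)
  qed
  hence "\<exists>v :: 'p padic_int. of_nat (fact k) * v = 1" if "k < CARD('p)" for k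
    using that by (metis dvdE)
  then obtain v :: "nat \<Rightarrow> 'p padic_int" where v: "of_nat (fact k) * v k = 1" if "k < CARD('p)" for k
    by metis
  have to_fract_v: "to_fract (v k) = 1 / of_nat (fact k)" if "k < CARD('p)" for k
  proof -
    have "of_nat (fact k) * to_fract (v k) = 1"
      using arg_cong[OF v[OF that], of to_fract] by (simp only: to_fract_mult to_fract_of_nat to_fract_1)
    moreover from this have "of_nat (fact k) \<noteq> (0 :: 'p padic)" by (metis mult_zero_left zero_neq_one)
    ultimately show ?thesis by (metis nonzero_eq_divide_eq mult.commute)
  qed
  \<comment> \<open>Of the two factors \<open>v k\<close>, one inverts the k! of the series and the
    other inverts (1)_k = k! from the lower parameter.\<close>
  define S where "S = (\<Sum>k<CARD('p). pochhammer \<alpha> k * v k * (pochhammer \<beta> k * v k))"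
  have *: "?P ^ d dvd pochhammer x k * v k - (- 1) ^ k * of_nat (m choose k)"
    if "?P ^ d dvd - x - of_nat m" "k < CARD('p)" for x m k
  proof -
    have "?P ^ d dvd - (- x - of_nat m)" using that(1) by (simp only: dvd_minus_iff)
    hence "?P ^ d dvd (pochhammer x k - pochhammer (- of_nat m) k) * v k"
      by (intro dvd_mult2 dvd_pochhammer_diff) (simp add: add.commute)
    also have "pochhammer (- of_nat m) k * v k = (- 1) ^ k * of_nat (m choose k) * (of_nat (fact k) * v k)"
      unfolding pochhammer_minus_of_nat by (simp only: ac_simps)
    hence "(pochhammer x k - pochhammer (- of_nat m) k) * v k =
        pochhammer x k * v k - (- 1) ^ k * of_nat (m choose k)"
      using v[OF that(2)] by (simp add: left_diff_distrib del: of_nat_fact)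
    finally show ?thesis .
  qed
  have "?P ^ d dvd pochhammer \<alpha> k * v k * (pochhammer \<beta> k * v k) - of_nat ((m choose k) * (n choose k))"
    if "k < CARD('p)" for k
    using dvd_mult_diff_mult[OF *[OF assms(1) that] *[OF assms(2) that]]
    by (simp add: algebra_simps flip: power_mult_distrib)
  hence "?P ^ d dvd (\<Sum>k<CARD('p). pochhammer \<alpha> k * v k * (pochhammer \<beta> k * v k) - of_nat ((m choose k) * (n choose k)))"
    by (intro dvd_sum) simp
  hence "?P ^ d dvd S - of_nat (\<Sum>k<CARD('p). (m choose k) * (n choose k))"
    by (simp add: S_def sum_subtractf)
  moreover have "hypergeo_trunc [to_fract \<alpha>, to_fract \<beta>] [1] 1 (CARD('p) - 1) = to_fract S"
  proof -
    have "Suc (CARD('p) - 1) = CARD('p)"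
      using prime_gt_0_nat[OF prime_card[where ?'a = 'p]] by (rule Suc_diff_1)
    hence "{..CARD('p) - 1} = {..<CARD('p)}" by (metis lessThan_Suc_atMost)
    moreover have "pochhammer 1 k = (of_nat (fact k) :: 'p padic)" for k
      using pochhammer_of_nat[of 1 k, where ?'a = "'p padic"] by (simp add: pochhammer_fact)
    ultimately show ?thesis
      unfolding hypergeo_trunc_def S_def to_fract_sum
      by (intro sum.cong) (simp_all add: to_fract_v to_fract_pochhammer)
  qed
  ultimately show ?thesis using that by blast
qed

text \<open>Since u is a unit, dividing by it keeps the error in p^n times the p-adic
  integers.\<close>

lemma padic_cong_divideI:
  assumes "of_nat CARD('p) ^ n dvd u * x - (y :: 'p::prime_card padic_int)" "\<not> of_nat CARD('p) dvd u"
  shows "padic_cong n (to_fract x) (to_fract y / to_fract u)"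
proof -
  from assms(1) obtain z where z: "u * x - y = of_nat CARD('p) ^ n * z" by (auto elim: dvdE)
  from padic_unit[OF assms(2)] obtain v where v: "1 = u * v" by (auto elim: dvdE)
  have "u \<noteq> 0" using assms(2) by auto
  have "u * (x - of_nat CARD('p) ^ n * (z * v)) = y"
    using z v by (metis (no_types, lifting) add_diff_cancel_left' diff_add_cancel mult.left_commute mult.right_neutral right_diff_distrib)
  hence "to_fract u * to_fract (x - of_nat CARD('p) ^ n * (z * v)) = to_fract y"
    by (simp only: flip: to_fract_mult)
  hence "to_fract y / to_fract u = to_fract (x - of_nat CARD('p) ^ n * (z * v))"
    using \<open>u \<noteq> 0\<close> by (auto simp: nonzero_divide_eq_eq mult.commute)
  hence "to_fract x - to_fract y / to_fract u = of_nat (CARD('p) ^ n) * to_fract (z * v)"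
    by (simp add: to_fract_of_nat[symmetric])
  thus ?thesis unfolding padic_cong_def of_nat_power by blast
qed

text \<open>The two cases differ only in the factor before the gamma quotient, so they are treated
  together.\<close>

lemma hypergeo_trunc_padic_cong:
  fixes \<alpha> \<beta> :: "'p::prime_card padic_int"
  assumes "odd CARD('p)"
  defines "a \<equiv> padic_residue (- \<alpha>)" and "b \<equiv> padic_residue (- \<beta>)"
  shows "padic_cong 2 (hypergeo_trunc [to_fract \<alpha>, to_fract \<beta>] [1] 1 (CARD('p) - 1))
    (to_fract (if a + b < CARD('p) then - 1 else \<alpha> + \<beta> + of_nat a + of_nat b - of_nat CARD('p)) *
      (to_fract (padic_Gamma (1 - \<alpha> - \<beta>)) / (to_fract (padic_Gamma (1 - \<alpha>)) * to_fract (padic_Gamma (1 - \<beta>)))))"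
proof -
  let ?p = "CARD('p)" and ?P = "of_nat CARD('p) :: 'p padic_int"
  obtain s where s: "?P ^ 2 dvd - \<alpha> - of_nat (?p * s + a)"
    unfolding a_def by (rule padic_residue_decompose)
  obtain t where t: "?P ^ 2 dvd - \<beta> - of_nat (?p * t + b)"
    unfolding b_def by (rule padic_residue_decompose)
  define m n where "m = ?p * s + a" and "n = ?p * t + b"
  note st = s[folded m_def] t[folded n_def]
  obtain S where S: "hypergeo_trunc [to_fract \<alpha>, to_fract \<beta>] [1] 1 (?p - 1) = to_fract S"
    "?P ^ 2 dvd S - of_nat (\<Sum>k<?p. (m choose k) * (n choose k))"
    using st by (rule hypergeo_trunc_padic)
  define e where "e = (if a + b < ?p then - 1 else - (int ?p * int (s + t + 1)))"
  define \<epsilon> where "\<epsilon> = (if a + b < ?p then - 1 else \<alpha> + \<beta> + of_nat a + of_nat b - ?P)"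
  \<comment> \<open>Applied with 1 - \<alpha>, 1 - \<beta> and 1 - \<alpha> - \<beta>, which are
    congruent modulo p^2 to m + 1, n + 1 and m + n + 1.\<close>
  have Gamma: "?P ^ 2 dvd padic_Gamma x - of_int (morita ?p k)" if "?P ^ 2 dvd x - of_nat k" for x k
    using padic_Gamma_dvd_diff[OF assms(1) that]
    by (simp add: padic_Gamma_of_nat[OF assms(1)] padic_Gamma_nat_eq_morita)
  have \<alpha>: "?P ^ 2 dvd padic_Gamma (1 - \<alpha>) - of_int (morita ?p (Suc m))"
    using st by (intro Gamma) (simp add: algebra_simps)
  have \<beta>: "?P ^ 2 dvd padic_Gamma (1 - \<beta>) - of_int (morita ?p (Suc n))"
    using st by (intro Gamma) (simp add: algebra_simps)
  have \<alpha>\<beta>: "?P ^ 2 dvd padic_Gamma (1 - \<alpha> - \<beta>) - of_int (morita ?p (Suc (m + n)))"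
    using dvd_add[OF st] by (intro Gamma) (simp add: algebra_simps)
  have e: "?P ^ 2 dvd \<epsilon> - of_int e"
  proof (cases "a + b < ?p")
    case False
    hence "\<epsilon> - of_int e = - ((- \<alpha> - of_nat m) + (- \<beta> - of_nat n))"
      by (simp add: \<epsilon>_def e_def m_def n_def algebra_simps)
    thus ?thesis using dvd_add[OF st] by (simp only: dvd_minus_iff)
  qed (simp add: \<epsilon>_def e_def)
  let ?L = "morita ?p (Suc m) * morita ?p (Suc n) * int (\<Sum>k<?p. (m choose k) * (n choose k))"
  have "[?L = e * morita ?p (Suc (m + n))] (mod (int ?p)\<^sup>2)"
    unfolding m_def n_def e_def
    using sum_binomial_mult_morita_cong[OF prime_card assms(1), of a b s t]
      padic_residue_less[of "- \<alpha>"] padic_residue_less[of "- \<beta>"] by (simp add: a_def b_def)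
  hence 1: "?P ^ 2 dvd of_int ?L - of_int (e * morita ?p (Suc (m + n)))"
    unfolding padic_power_dvd_of_int_diff_iff by simp
  have 2: "?P ^ 2 dvd padic_Gamma (1 - \<alpha>) * padic_Gamma (1 - \<beta>) * S - of_int ?L"
    unfolding of_int_mult of_int_of_nat_eq by (intro dvd_mult_diff_mult \<alpha> \<beta> S(2))
  have 3: "?P ^ 2 dvd \<epsilon> * padic_Gamma (1 - \<alpha> - \<beta>) - of_int (e * morita ?p (Suc (m + n)))"
    unfolding of_int_mult by (intro dvd_mult_diff_mult e \<alpha>\<beta>)
  have "?P ^ 2 dvd padic_Gamma (1 - \<alpha>) * padic_Gamma (1 - \<beta>) * S - \<epsilon> * padic_Gamma (1 - \<alpha> - \<beta>)"
    using dvd_diff[OF dvd_add[OF 2 1] 3] by simp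
  moreover have "\<not> ?P dvd padic_Gamma (1 - \<alpha>) * padic_Gamma (1 - \<beta>)"
  proof
    \<comment> \<open>Divisibility by p can be tested on the integer approximations, where no gamma
      value is a multiple of p.\<close>
    assume *: "?P dvd padic_Gamma (1 - \<alpha>) * padic_Gamma (1 - \<beta>)"
    have "?P dvd padic_Gamma (1 - \<alpha>) * padic_Gamma (1 - \<beta>) - of_int (morita ?p (Suc m) * morita ?p (Suc n))"
      unfolding of_int_mult
      by (rule dvd_trans[OF _ dvd_mult_diff_mult[OF \<alpha> \<beta>]]) (simp add: power2_eq_square)
    from dvd_diff[OF * this] have "?P ^ 1 dvd of_int (morita ?p (Suc m) * morita ?p (Suc n)) - of_int 0"
      by simp
    hence "int ?p dvd morita ?p (Suc m) * morita ?p (Suc n)"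
      unfolding padic_power_dvd_of_int_diff_iff by (simp add: cong_0_iff)
    thus False
      using not_dvd_morita[OF prime_card] prime_card[where ?'a = 'p] by (auto simp: prime_dvd_mult_iff)
  qed
  ultimately have "padic_cong 2 (to_fract S)
      (to_fract (\<epsilon> * padic_Gamma (1 - \<alpha> - \<beta>)) / to_fract (padic_Gamma (1 - \<alpha>) * padic_Gamma (1 - \<beta>)))"
    by (rule padic_cong_divideI)
  thus ?thesis unfolding S(1) \<epsilon>_def by simp
qed

theorem theorem1p1:
  fixes p :: nat and \<alpha> \<beta> :: "'p::prime_card padic_int"
  assumes "p = CARD('p)" and "odd p"
  shows "(padic_residue (- \<alpha>) + padic_residue (- \<beta>) < p \<longrightarrow>
      padic_cong 2
        (hypergeo_trunc [to_fract \<alpha>, to_fract \<beta>] [1] 1 (p - 1))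
        (- (to_fract (padic_Gamma (1 - \<alpha> - \<beta>))
            / (to_fract (padic_Gamma (1 - \<alpha>)) * to_fract (padic_Gamma (1 - \<beta>)))))) \<and>
    (padic_residue (- \<alpha>) + padic_residue (- \<beta>) \<ge> p \<longrightarrow>
      padic_cong 2
        (hypergeo_trunc [to_fract \<alpha>, to_fract \<beta>] [1] 1 (p - 1))
        (to_fract (\<alpha> + \<beta> + of_nat (padic_residue (- \<alpha>)) + of_nat (padic_residue (- \<beta>)) - of_nat p)
          * (to_fract (padic_Gamma (1 - \<alpha> - \<beta>))
            / (to_fract (padic_Gamma (1 - \<alpha>)) * to_fract (padic_Gamma (1 - \<beta>))))))"
proof (intro conjI impI)
  note cong = hypergeo_trunc_padic_cong[of \<alpha> \<beta>, folded assms(1), OF assms(2)]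
  {
    assume "padic_residue (- \<alpha>) + padic_residue (- \<beta>) < p"
    with cong show "padic_cong 2
        (hypergeo_trunc [to_fract \<alpha>, to_fract \<beta>] [1] 1 (p - 1))
        (- (to_fract (padic_Gamma (1 - \<alpha> - \<beta>))
            / (to_fract (padic_Gamma (1 - \<alpha>)) * to_fract (padic_Gamma (1 - \<beta>)))))"
      by (simp only: if_True to_fract_uminus to_fract_1 mult_minus1)
  next
    assume "p \<le> padic_residue (- \<alpha>) + padic_residue (- \<beta>)"
    with cong show "padic_cong 2
        (hypergeo_trunc [to_fract \<alpha>, to_fract \<beta>] [1] 1 (p - 1))
        (to_fract (\<alpha> + \<beta> + of_nat (padic_residue (- \<alpha>)) + of_nat (padic_residue (- \<beta>)) - of_nat p)
          * (to_fract (padic_Gamma (1 - \<alpha> - \<beta>))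
            / (to_fract (padic_Gamma (1 - \<alpha>)) * to_fract (padic_Gamma (1 - \<beta>)))))"
      by (simp only: if_False not_less[symmetric])
  }
qed

end
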